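(* Let $\alpha\in(0,1)$ and $\gamma\in[0,1)$, and put $$r_s(\alpha,\gamma)=\frac{\sqrt{1+4\alpha(1-\gamma)^2}-1}{2\alpha(1-\gamma)}.$$ If $f\in\mathcal{BS}(\alpha)$, then $f$ is starlike of order $\gamma$ in the disc $|z|<r_s(\alpha,\gamma)$. The result is sharp: $r_s(\alpha,\gamma)$ is the largest radius with the property that every $f\in\mathcal{BS}(\alpha)$ is starlike of order $\gamma$ in the disc $|z|<r_s(\alpha,\gamma)$.
   Context: $\Delta=\{z\in\mathbb{C}:|z|<1\}$, and $\mathcal{A}$ is the class of analytic functions $f$ on $\Delta$ with $f(0)=0$ and $f'(0)=1$. For analytic functions $f,g$ on $\Delta$, $f\prec g$ ($f$ is subordinate to $g$) means that there is an analytic function $w$ on $\Delta$ with $w(0)=0$ and $|w(z)|<1$ for all $z\in\Delta$ such that $f(z)=g(w(z))$ for all $z\in\Delta$. For $0\le\alpha<1$, $\mathcal{BS}(\alpha)$ is the class of $f\in\mathcal{A}$ such that $\frac{zf'(z)}{f(z)}-1\prec\frac{z}{1-\alpha z^2}$ in $\Delta$ (in particular $zf'(z)/f(z)$ is analytic in $\Delta$, with value $1$ at $z=0$). A function $f\in\mathcal{A}$ is starlike of order $\gamma$ in the disc $|z|<r$ if $\mathrm{Re}\left\{\frac{zf'(z)}{f(z)}\right\}>\gamma$ for all $|z|<r$. *)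

theory Defs
  imports "HOL-Analysis.Analysis"
begin

text \<open>
  Functions on the unit disc are modelled by total functions on the complex numbers; only their
  values on the disc matter. On an open set, analytic and holomorphic are synonymous.
\<close>

abbreviation unit_disc :: "complex set" where
  "unit_disc \<equiv> ball 0 1"

definition class_A :: "(complex \<Rightarrow> complex) set" where
  "class_A = {f. f holomorphic_on unit_disc \<and> f 0 = 0 \<and> deriv f 0 = 1}"

definition subordinate :: "(complex \<Rightarrow> complex) \<Rightarrow> (complex \<Rightarrow> complex) \<Rightarrow> bool"
    (infix \<open>\<prec>\<close> 50) where
  "f \<prec> g \<longleftrightarrow> f holomorphic_on unit_disc \<and> g holomorphic_on unit_disc \<and>
    (\<exists>w. w holomorphic_on unit_disc \<and> w 0 = 0 \<and> (\<forall>z\<in>unit_disc. norm (w z) < 1) \<and>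
         (\<forall>z\<in>unit_disc. f z = g (w z)))"

text \<open>
  The quotient $z f'(z) / f(z)$, with its removable singularity at the origin filled in: for
  a function with $f(0) = 0$ and $f'(0) = 1$ the limit there is $1$.
\<close>

definition starlike_quot :: "(complex \<Rightarrow> complex) \<Rightarrow> complex \<Rightarrow> complex" where
  "starlike_quot f z = (if z = 0 then 1 else z * deriv f z / f z)"

text \<open>
  Since subordination demands holomorphy of the left-hand side, membership in \<open>BS \<alpha>\<close> excludes
  zeros of \<open>f\<close> in the punctured disc: there the quotient is unbounded, whatever value division
  by zero assigns to it at the zero itself.
\<close>

definition BS :: "real \<Rightarrow> (complex \<Rightarrow> complex) set" where
  "BS \<alpha> = {f \<in> class_A.
     (\<lambda>z. starlike_quot f z - 1) \<prec> (\<lambda>z. z / (1 - of_real \<alpha> * z\<^sup>2))}"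

text \<open>
  If \<open>f\<close> vanishes at a point of the punctured disc, the quotient is \<open>0\<close> there by the convention
  for division by zero, so the inequality fails for every \<open>\<gamma> \<ge> 0\<close>.
\<close>

definition starlike_of_order_in_disc :: "real \<Rightarrow> real \<Rightarrow> (complex \<Rightarrow> complex) \<Rightarrow> bool" where
  "starlike_of_order_in_disc \<gamma> r f \<longleftrightarrow>
     f \<in> class_A \<and> (\<forall>z. norm z < r \<longrightarrow> Re (starlike_quot f z) > \<gamma>)"

definition r_s :: "real \<Rightarrow> real \<Rightarrow> real" where
  "r_s \<alpha> \<gamma> = (sqrt (1 + 4 * \<alpha> * (1 - \<gamma>)\<^sup>2) - 1) / (2 * \<alpha> * (1 - \<gamma>))"

end

theory Submission
  imports Defs "HOL-Complex_Analysis.Conformal_Mappings"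
begin

text \<open>
  The bound rests on one inequality. If \<open>f \<in> BS \<alpha>\<close>, the quotient \<open>z f'(z) / f(z)\<close> is
  \<open>1 + w / (1 - \<alpha> w\<^sup>2)\<close> with \<open>w = w(z)\<close> a Schwarz function, so \<open>\<bar>w\<bar> \<le> \<bar>z\<bar>\<close> by the Schwarz lemma.
  Since \<open>\<bar>1 - \<alpha> w\<^sup>2\<bar> \<ge> 1 - \<alpha> \<bar>w\<bar>\<^sup>2\<close>, the quotient differs from \<open>1\<close> by at most
  \<open>\<rho> / (1 - \<alpha> \<rho>\<^sup>2)\<close> with \<open>\<rho> = \<bar>z\<bar>\<close>. This majorant increases with \<open>\<rho>\<close>, and \<open>r_s \<alpha> \<gamma>\<close> is
  exactly the radius at which it reaches \<open>1 - \<gamma>\<close>.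

  The majorant is attained at negative real points by the function whose Schwarz function is the
  identity. That function is \<open>z exp (G z)\<close>, where \<open>G\<close> is the primitive of \<open>1 / (1 - \<alpha> z\<^sup>2)\<close> with
  \<open>G 0 = 0\<close>; its quotient equals \<open>\<gamma>\<close> at \<open>- r_s \<alpha> \<gamma>\<close>, so no larger disc will do.
\<close>

text \<open>
  The radius is the positive root of \<open>\<alpha> b r\<^sup>2 + r - b = 0\<close> with \<open>b = 1 - \<gamma>\<close>. The root lies
  below \<open>1\<close> because the quadratic is positive there.
\<close>

lemma r_s_pos_less_one_root:
  fixes \<alpha> \<gamma> :: real
  assumes "0 < \<alpha>" "0 \<le> \<gamma>" "\<gamma> < 1"
  shows "0 < r_s \<alpha> \<gamma>" and "r_s \<alpha> \<gamma> < 1"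
    and "r_s \<alpha> \<gamma> = (1 - \<gamma>) * (1 - \<alpha> * (r_s \<alpha> \<gamma>)\<^sup>2)"
proof -
  define b where "b = 1 - \<gamma>"
  define s where "s = sqrt (1 + 4 * \<alpha> * b\<^sup>2)"
  define r where "r = (s - 1) / (2 * \<alpha> * b)"
  have r: "r_s \<alpha> \<gamma> = r" by (simp add: r_s_def r_def s_def b_def)
  have b: "0 < b" "b \<le> 1" using assms by (auto simp: b_def)
  have ab: "0 < \<alpha> * b" using assms b by simp
  have s2: "s\<^sup>2 = 1 + 4 * \<alpha> * b\<^sup>2" using assms by (simp add: s_def)
  have s1: "1 < s" using assms b by (simp add: s_def)
  show pos: "0 < r_s \<alpha> \<gamma>" unfolding r r_def using s1 assms b by simp
  have s: "s = 2 * (\<alpha> * b) * r + 1" using assms b by (simp add: r_def)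
  have "4 * (\<alpha> * b) * (\<alpha> * b * r\<^sup>2 + r - b) = 0"
    using s2 unfolding s by (simp add: power2_eq_square algebra_simps)
  then have root: "\<alpha> * b * r\<^sup>2 + r - b = 0" using ab by auto
  then show "r_s \<alpha> \<gamma> = (1 - \<gamma>) * (1 - \<alpha> * (r_s \<alpha> \<gamma>)\<^sup>2)"
    unfolding r b_def[symmetric] by (simp add: algebra_simps)
  have "0 < \<alpha> * b * r\<^sup>2" using ab pos r by simp
  then show "r_s \<alpha> \<gamma> < 1" using root b unfolding r by linarith
qed

lemma one_minus_mult_power2_pos:
  fixes \<alpha> \<rho> :: real
  assumes "0 \<le> \<alpha>" "\<alpha> < 1" "0 \<le> \<rho>" "\<rho> < 1"
  shows "0 < 1 - \<alpha> * \<rho>\<^sup>2"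
proof -
  have "\<rho>\<^sup>2 \<le> 1" using assms by (simp add: power_le_one)
  then have "\<alpha> * \<rho>\<^sup>2 \<le> \<alpha>" using assms by (simp add: mult_left_le)
  then show ?thesis using assms by linarith
qed

lemma one_minus_mult_power2_nonzero:
  fixes z :: complex
  assumes "0 \<le> \<alpha>" "\<alpha> < 1" "norm z < 1"
  shows "1 - of_real \<alpha> * z\<^sup>2 \<noteq> 0"
proof
  assume "1 - of_real \<alpha> * z\<^sup>2 = 0"
  then have "norm (of_real \<alpha> * z\<^sup>2) = 1" by simp
  then show False
    using one_minus_mult_power2_pos[of \<alpha> "norm z"] assms by (simp add: norm_mult norm_power)
qed

text \<open>
  The inequality is strict since \<open>\<rho> / (1 - \<alpha> \<rho>\<^sup>2)\<close> is strictly increasing on \<open>[0, 1)\<close>.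
\<close>

lemma norm_booth_less:
  fixes u :: complex
  assumes "0 \<le> \<alpha>" "\<alpha> < 1" "norm u < r" "r < 1"
  shows "norm (u / (1 - of_real \<alpha> * u\<^sup>2)) < r / (1 - \<alpha> * r\<^sup>2)"
proof -
  have r: "0 < r" using assms(3) norm_ge_zero[of u] by linarith
  have pos: "0 < 1 - \<alpha> * r\<^sup>2" using one_minus_mult_power2_pos assms r by simp
  have "(norm u)\<^sup>2 \<le> r\<^sup>2" using assms by (intro power_mono) auto
  then have "1 - \<alpha> * r\<^sup>2 \<le> 1 - \<alpha> * (norm u)\<^sup>2" using assms by (simp add: mult_left_mono)
  also have "\<dots> \<le> norm (1 - of_real \<alpha> * u\<^sup>2)"
    using norm_triangle_ineq2[of 1 "of_real \<alpha> * u\<^sup>2"] assms by (simp add: norm_mult norm_power)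
  finally have "norm (u / (1 - of_real \<alpha> * u\<^sup>2)) \<le> norm u / (1 - \<alpha> * r\<^sup>2)"
    using pos unfolding norm_divide by (intro divide_left_mono mult_pos_pos) auto
  also have "\<dots> < r / (1 - \<alpha> * r\<^sup>2)" using assms pos by (simp add: divide_strict_right_mono)
  finally show ?thesis .
qed

lemma BS_starlike_of_order:
  assumes "0 < \<alpha>" "\<alpha> < 1" "0 \<le> \<gamma>" "\<gamma> < 1" and f: "f \<in> BS \<alpha>"
  shows "starlike_of_order_in_disc \<gamma> (r_s \<alpha> \<gamma>) f"
proof -
  let ?r = "r_s \<alpha> \<gamma>"
  note rs = r_s_pos_less_one_root[OF assms(1,3,4)]
  obtain w where w: "w holomorphic_on unit_disc" "w 0 = 0" "\<And>z. norm z < 1 \<Longrightarrow> norm (w z) < 1"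
    and eq: "\<And>z. norm z < 1 \<Longrightarrow>
      starlike_quot f z - 1 = w z / (1 - of_real \<alpha> * (w z)\<^sup>2)"
    using f by (auto simp: BS_def subordinate_def)
  have "0 < 1 - \<alpha> * ?r\<^sup>2" using one_minus_mult_power2_pos[of \<alpha> ?r] assms rs(1,2) by simp
  then have reach: "?r / (1 - \<alpha> * ?r\<^sup>2) = 1 - \<gamma>"
    using rs(3) by (simp add: divide_eq_eq)
  have "\<gamma> < Re (starlike_quot f z)" if z: "norm z < ?r" for z
  proof -
    have z1: "norm z < 1" using z rs(2) by simp
    have "norm (w z) \<le> norm z" using Schwarz_Lemma(1)[OF w(1,2,3)] z1 by blast
    then have "norm (w z) < ?r" using z by simp
    then have "norm (starlike_quot f z - 1) < 1 - \<gamma>"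
      using norm_booth_less[of \<alpha> "w z" ?r] assms rs(2) reach eq[OF z1] by simp
    then show ?thesis using abs_Re_le_cmod[of "starlike_quot f z - 1"] by simp
  qed
  then show ?thesis using f by (simp add: starlike_of_order_in_disc_def BS_def)
qed

text \<open>
  Solving \<open>z f'(z) / f(z) - 1 = z / (1 - \<alpha> z\<^sup>2)\<close> for \<open>f\<close> means integrating the logarithmic
  derivative of \<open>f(z) / z\<close>, which is \<open>1 / (1 - \<alpha> z\<^sup>2)\<close>; a primitive exists because the disc is
  convex.
\<close>

lemma BS_extremal_function:
  assumes "0 \<le> \<alpha>" "\<alpha> < 1"
  obtains f where "f \<in> BS \<alpha>"
    and "\<And>z. norm z < 1 \<Longrightarrow> starlike_quot f z = 1 + z / (1 - of_real \<alpha> * z\<^sup>2)"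
proof -
  note nz = one_minus_mult_power2_nonzero[OF assms]
  have "(\<lambda>z::complex. 1 / (1 - of_real \<alpha> * z\<^sup>2)) holomorphic_on unit_disc"
    using nz by (intro holomorphic_intros) auto
  then obtain F where F: "\<And>z. z \<in> unit_disc \<Longrightarrow>
      (F has_field_derivative 1 / (1 - of_real \<alpha> * z\<^sup>2)) (at z)"
    using holomorphic_convex_primitive'[OF convex_ball open_ball]
    by (metis at_within_open open_ball)
  define f where "f z = z * exp (F z - F 0)" for z
  have deriv: "(f has_field_derivative
      exp (F z - F 0) * (1 + z / (1 - of_real \<alpha> * z\<^sup>2))) (at z)" if "norm z < 1" for z
    unfolding f_def using F[of z] that
    by (auto intro!: derivative_eq_intros simp: algebra_simps)
  have deriv_f: "deriv f z = exp (F z - F 0) * (1 + z / (1 - of_real \<alpha> * z\<^sup>2))"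
    if "norm z < 1" for z using deriv[OF that] by (rule DERIV_imp_deriv)
  have A: "f \<in> class_A"
  proof -
    have "f holomorphic_on unit_disc"
      unfolding holomorphic_on_open[OF open_ball] using deriv by (auto intro!: exI)
    then show ?thesis using deriv_f[of 0] by (simp add: class_A_def f_def[of 0])
  qed
  have quot: "starlike_quot f z = 1 + z / (1 - of_real \<alpha> * z\<^sup>2)" if "norm z < 1" for z
    using deriv_f[OF that] by (simp add: starlike_quot_def f_def)
  have hol: "(\<lambda>z::complex. z / (1 - of_real \<alpha> * z\<^sup>2)) holomorphic_on unit_disc"
    using nz by (intro holomorphic_intros) auto
  moreover have "(\<lambda>z. starlike_quot f z - 1) holomorphic_on unit_disc"
    using hol by (rule holomorphic_transform) (simp add: quot)
  moreover have "\<exists>w. w holomorphic_on unit_disc \<and> w 0 = 0 \<and> (\<forall>z\<in>unit_disc. norm (w z) < 1) \<and>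
      (\<forall>z\<in>unit_disc. starlike_quot f z - 1 = w z / (1 - of_real \<alpha> * (w z)\<^sup>2))"
    by (rule exI[of _ "\<lambda>z. z"]) (auto simp: quot)
  ultimately have "f \<in> BS \<alpha>" using A by (simp add: BS_def subordinate_def)
  then show thesis using quot that by blast
qed

theorem theorem2p1:
  fixes \<alpha> \<gamma> :: real
  assumes "0 < \<alpha>" and "\<alpha> < 1" and "0 \<le> \<gamma>" and "\<gamma> < 1"
  shows "(\<forall>f \<in> BS \<alpha>. starlike_of_order_in_disc \<gamma> (r_s \<alpha> \<gamma>) f) \<and>
    0 < r_s \<alpha> \<gamma> \<and> r_s \<alpha> \<gamma> \<le> 1 \<and>
    (\<forall>r. 0 < r \<and> r \<le> 1 \<and> (\<forall>f \<in> BS \<alpha>. starlike_of_order_in_disc \<gamma> r f) \<longrightarrow> r \<le> r_s \<alpha> \<gamma>)"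
proof -
  let ?r = "r_s \<alpha> \<gamma>"
  note rs = r_s_pos_less_one_root[OF assms(1,3,4)]
  obtain f where f: "f \<in> BS \<alpha>"
    and quot: "\<And>z. norm z < 1 \<Longrightarrow> starlike_quot f z = 1 + z / (1 - of_real \<alpha> * z\<^sup>2)"
    using BS_extremal_function[of \<alpha>] assms by auto
  have "0 < 1 - \<alpha> * ?r\<^sup>2" using one_minus_mult_power2_pos[of \<alpha> ?r] assms rs(1,2) by simp
  then have reach: "?r / (1 - \<alpha> * ?r\<^sup>2) = 1 - \<gamma>"
    using rs(3) by (simp add: divide_eq_eq)
  have "starlike_quot f (- of_real ?r) = of_real (1 - ?r / (1 - \<alpha> * ?r\<^sup>2))"
    using quot[of "- of_real ?r"] rs(1,2) by simp
  then have extremal: "Re (starlike_quot f (- of_real ?r)) = \<gamma>" using reach by simp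
  have "r \<le> ?r" if "\<forall>f \<in> BS \<alpha>. starlike_of_order_in_disc \<gamma> r f" for r
  proof (rule ccontr)
    assume "\<not> r \<le> ?r"
    then have "norm (- of_real ?r :: complex) < r" using rs(1) by simp
    then have "\<gamma> < Re (starlike_quot f (- of_real ?r))"
      using that f unfolding starlike_of_order_in_disc_def by blast
    then show False using extremal by simp
  qed
  then show ?thesis using BS_starlike_of_order[OF assms] rs(1,2) by auto
qed

end
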